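(* Let $U$ be a finite set with $|U|=k\ge1$ and let $z_S\ge0$ be nonnegative reals indexed by subsets $S\subseteq U$. Define $\ell(p)=\sum_{S\subseteq U:\,p\in S}z_S$ for $p\in U$, and define $f$ on nonempty subsets of $U$ recursively by $f(\{p\})=\ell(p)$ and, for $|S|\ge2$, $$f(S)=\frac{\sum_{E\in\mathcal{C}_S}z_E\,f(S\setminus E)}{\sum_{E\in\mathcal{C}_S}z_E},$$ with $f(S)=0$ if $\sum_{E\in\mathcal{C}_S}z_E=0$, where $\mathcal{C}_S$ is the family of subsets $E\subseteq U$ that cross $S$ (i.e., $E\cap S$ and $S\setminus E$ are both nonempty). Then for every point $p\in U$, $$f(U)\le(1+H_{k-1})\,\ell(p),$$ where $H_{k-1}=\sum_{j=1}^{k-1}1/j$.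
   Context: This is the algebraic form of the expected $\ell_1$-norm of the point of $U$ surviving in the origin's leaf under the Random Thresholds algorithm, when each point $p$ is embedded with coordinate $z_S\mathbf{1}[p\in S]$ in a dimension indexed by each $S\subseteq U$. *)

theory Defs
  imports "HOL-Analysis.Analysis"
begin

definition ell :: "'a set \<Rightarrow> ('a set \<Rightarrow> real) \<Rightarrow> 'a \<Rightarrow> real" where
  "ell U z p = (\<Sum>S\<in>{S. S \<subseteq> U \<and> p \<in> S}. z S)"

definition crossing :: "'a set \<Rightarrow> 'a set \<Rightarrow> 'a set set" where
  "crossing U S = {E. E \<subseteq> U \<and> E \<inter> S \<noteq> {} \<and> S - E \<noteq> {}}"

text \<open>The recursively defined f on nonempty subsets (value 0 on the empty/infinite set, irrelevant).\<close>
function rtf :: "'a set \<Rightarrow> ('a set \<Rightarrow> real) \<Rightarrow> 'a set \<Rightarrow> real" where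
  "rtf U z S =
     (if finite S \<and> card S \<ge> 2 then
        (if (\<Sum>E\<in>crossing U S. z E) = 0 then 0
         else (\<Sum>E\<in>crossing U S. z E * rtf U z (S - E)) / (\<Sum>E\<in>crossing U S. z E))
      else if card S = 1 then ell U z (the_elem S) else 0)"
  by pat_completeness auto
termination
proof (relation "Wellfounded.measure (\<lambda>(U, z, S). card S)")
  show "wf (Wellfounded.measure (\<lambda>(U, z, S). card S))" by simp
next
  fix U :: "'a set" and z S E
  assume "finite S \<and> 2 \<le> card S" "E \<in> crossing U S"
  then show "((U, z, S - E), U, z, S) \<in> Wellfounded.measure (\<lambda>(U, z, S). card S)"
    by (auto simp: crossing_def intro!: psubset_card_mono)
qed

end

theory Submission
  imports Defs
begin

text \<open>Let every cut \<open>E\<close> arrive at rate \<open>z E\<close>; then \<open>f(U)\<close> is the expected norm of the survivor \<open>X\<close>.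
  Cuts containing \<open>p\<close> contribute at most \<open>\<ell>(p)\<close> to it. Cuts avoiding \<open>p\<close> contribute only if some
  crossing \<open>B\<close> containing \<open>p\<close> arrives while the survivor \<open>X\<^sub>B\<close> of \<open>U - B\<close> is not yet hit by a cut
  avoiding \<open>p\<close>, i.e. before a time \<open>T\<close>; their contribution is hence at most
  \<open>\<Sum>\<^sub>B z B \<cdot> E[\<ell>'(X\<^sub>B) T]\<close>, where \<open>\<ell>'\<close> counts the cuts avoiding \<open>p\<close>. For every fixed point \<open>x\<close>,
  \<open>\<ell>'(x)\<close> times its first hitting time is a standard exponential, and these variables are positively
  associated, so the expectation is at most that of the maximum of \<open>|U - B| \<le> k - 1\<close> independent
  exponentials, which is \<open>H\<close> of their number. Instead of constructing the random variables, the
  comparison with independent exponentials is carried out by a time-dependent potential that is a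
  supersolution of the recursion.\<close>

section \<open>Expected maxima of shifted exponentials, and a comparison principle\<close>

text \<open>The expected maximum of \<open>e\<^sub>x + ln (c x)\<close> and \<open>0\<close>, for independent standard exponential
  variables \<open>e\<^sub>x\<close> and \<open>0 \<le> c x \<le> 1\<close>. The term \<open>T = {}\<close> vanishes because \<open>x / 0 = 0\<close>.\<close>

definition exp_max :: "'a set \<Rightarrow> ('a \<Rightarrow> real) \<Rightarrow> real" where
  "exp_max S c = (\<Sum>T\<in>Pow S. (-1) ^ (card T + 1) * (\<Prod>x\<in>T. c x) / card T)"

lemma prod_one_minus_expand:
  fixes b :: "'a \<Rightarrow> real"
  assumes "finite S"
  shows "(\<Prod>x\<in>S. 1 - b x) = (\<Sum>T\<in>Pow S. (-1) ^ card T * (\<Prod>x\<in>T. b x))"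
  using assms
proof (induction S)
  case (insert a S)
  have inj: "inj_on (insert a) (Pow S)"
    using insert.hyps by (auto simp: inj_on_def)
  have "(\<Sum>T\<in>Pow (insert a S). (-1) ^ card T * (\<Prod>x\<in>T. b x))
      = (\<Sum>T\<in>Pow S. (-1) ^ card T * (\<Prod>x\<in>T. b x))
        + (\<Sum>T\<in>insert a ` Pow S. (-1) ^ card T * (\<Prod>x\<in>T. b x))"
    unfolding Pow_insert using insert.hyps by (intro sum.union_disjoint) auto
  also have "(\<Sum>T\<in>insert a ` Pow S. (-1) ^ card T * (\<Prod>x\<in>T. b x))
      = (\<Sum>T\<in>Pow S. - b a * ((-1) ^ card T * (\<Prod>x\<in>T. b x)))"
    unfolding sum.reindex[OF inj] o_def
  proof (intro sum.cong refl)
    fix T assume "T \<in> Pow S"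
    then have "finite T" "a \<notin> T"
      using insert.hyps finite_subset by auto
    then show "(-1) ^ card (insert a T) * prod b (insert a T) = - b a * ((-1) ^ card T * prod b T)"
      by simp
  qed
  also have "\<dots> = - b a * (\<Prod>x\<in>S. 1 - b x)"
    by (simp only: sum_distrib_left[symmetric] insert.IH)
  finally show ?case
    using insert by (simp add: algebra_simps)
qed simp

text \<open>Termwise integration of a nonnegative polynomial against \<open>da / a\<close> on the unit interval.\<close>

lemma sum_div_exponent_nonneg:
  fixes \<kappa> :: "'i \<Rightarrow> real" and n :: "'i \<Rightarrow> nat"
  assumes "finite I"
    and zero: "\<And>i. i \<in> I \<Longrightarrow> n i = 0 \<Longrightarrow> \<kappa> i = 0"
    and pos: "\<And>a. 0 < a \<Longrightarrow> a < 1 \<Longrightarrow> 0 \<le> (\<Sum>i\<in>I. \<kappa> i * a ^ n i)"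
  shows "0 \<le> (\<Sum>i\<in>I. \<kappa> i / n i)"
proof -
  define F where "F a = (\<Sum>i\<in>I. \<kappa> i / n i * a ^ n i)" for a :: real
  have der: "(F has_real_derivative (\<Sum>i\<in>I. \<kappa> i * a ^ (n i - 1))) (at a)" for a
    unfolding F_def
  proof (intro DERIV_sum)
    fix i assume "i \<in> I"
    show "((\<lambda>a. \<kappa> i / n i * a ^ n i) has_real_derivative \<kappa> i * a ^ (n i - 1)) (at a)"
    proof (cases "n i = 0")
      case True
      then show ?thesis using zero[OF \<open>i \<in> I\<close>] by simp
    next
      case False
      then show ?thesis
        by (auto intro!: derivative_eq_intros)
    qed
  qed
  have "F 0 \<le> F 1"
  proof (rule DERIV_nonneg_imp_increasing_open[where f = F])
    fix a :: real assume a: "0 < a" "a < 1"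
    have "a * (\<Sum>i\<in>I. \<kappa> i * a ^ (n i - 1)) = (\<Sum>i\<in>I. \<kappa> i * a ^ n i)"
      unfolding sum_distrib_left
    proof (intro sum.cong refl)
      fix i assume "i \<in> I"
      show "a * (\<kappa> i * a ^ (n i - 1)) = \<kappa> i * a ^ n i"
        using zero[OF \<open>i \<in> I\<close>] by (cases "n i") auto
    qed
    then have "0 \<le> a * (\<Sum>i\<in>I. \<kappa> i * a ^ (n i - 1))"
      using pos[OF a] by simp
    then have "0 \<le> (\<Sum>i\<in>I. \<kappa> i * a ^ (n i - 1))"
      using a by (simp add: zero_le_mult_iff)
    then show "\<exists>y. (F has_real_derivative y) (at a) \<and> 0 \<le> y"
      using der by blast
  next
    show "continuous_on {0..1} F"
      unfolding F_def by (intro continuous_intros)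
  qed simp
  moreover have "F 0 = 0"
    unfolding F_def by (intro sum.neutral) (auto simp: zero power_0_left)
  ultimately show ?thesis
    by (simp add: F_def)
qed

text \<open>For independent events of probabilities \<open>b x\<close>, exactly one occurring is a
  case of at least one occurring; the induction conditions on the event of the new element.\<close>

lemma exactly_one_le_at_least_one:
  fixes b :: "'a \<Rightarrow> real"
  assumes "finite F" "\<And>x. x \<in> F \<Longrightarrow> 0 \<le> b x \<and> b x \<le> 1"
  shows "(\<Sum>x\<in>F. b x * (\<Prod>v\<in>F-{x}. 1 - b v)) \<le> 1 - (\<Prod>x\<in>F. 1 - b x)"
  using assms
proof (induction F)
  case (insert a F)
  define P where "P = (\<Prod>x\<in>F. 1 - b x)"
  have P: "0 \<le> P" "P \<le> 1"
    unfolding P_def using insert.prems by (auto intro!: prod_nonneg prod_le_1)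
  have "(\<Sum>x\<in>F. b x * (\<Prod>v\<in>insert a F-{x}. 1 - b v))
      = (1 - b a) * (\<Sum>x\<in>F. b x * (\<Prod>v\<in>F-{x}. 1 - b v))"
    unfolding sum_distrib_left
  proof (intro sum.cong refl)
    fix x assume "x \<in> F"
    then have "insert a F - {x} = insert a (F - {x})" "a \<notin> F - {x}"
      using insert.hyps by auto
    then show "b x * (\<Prod>v\<in>insert a F-{x}. 1 - b v) = (1 - b a) * (b x * (\<Prod>v\<in>F-{x}. 1 - b v))"
      using insert.hyps by simp
  qed
  also have "\<dots> \<le> (1 - b a) * (1 - P)"
    using insert unfolding P_def by (intro mult_left_mono) auto
  finally have "(\<Sum>x\<in>F. b x * (\<Prod>v\<in>insert a F-{x}. 1 - b v)) \<le> (1 - b a) * (1 - P)" .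
  moreover have "insert a F - {a} = F"
    using insert.hyps by auto
  moreover have "b a * P \<le> b a * 1"
    using insert.prems P by (intro mult_left_mono) auto
  ultimately show ?case
    using insert.hyps by (simp add: P_def[symmetric] algebra_simps)
qed simp

text \<open>Write \<open>card (T \<inter> E)\<close> as a sum of indicators over \<open>x\<close>
  and remove \<open>x\<close> from \<open>T\<close>: inclusion-exclusion on \<open>S - {x}\<close>
  remains. For probabilities \<open>b\<close> this is the chance that exactly one event of
  \<open>S\<close> occurs and that its index lies in \<open>E\<close>.\<close>

lemma sum_Pow_card_Int:
  fixes b :: "'a \<Rightarrow> real"
  assumes "finite S"
  shows "(\<Sum>T\<in>Pow S. (-1) ^ (card T + 1) * card (T \<inter> E) * (\<Prod>x\<in>T. b x))
       = (\<Sum>x\<in>S \<inter> E. b x * (\<Prod>v\<in>S-{x}. 1 - b v))"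
proof -
  define s where "s T = (-1) ^ (card T + 1) * (\<Prod>x\<in>T. b x)" for T
  have "(\<Sum>T\<in>Pow S. (-1) ^ (card T + 1) * card (T \<inter> E) * (\<Prod>x\<in>T. b x))
      = (\<Sum>T\<in>Pow S. \<Sum>x\<in>S \<inter> E. if x \<in> T then s T else 0)"
  proof (intro sum.cong refl)
    fix T assume "T \<in> Pow S"
    then have "T \<inter> E = {x \<in> S \<inter> E. x \<in> T}" by auto
    then have "(\<Sum>x\<in>S \<inter> E. if x \<in> T then s T else 0) = card (T \<inter> E) * s T"
      using assms by (simp add: sum.inter_filter[symmetric])
    then show "(-1) ^ (card T + 1) * card (T \<inter> E) * (\<Prod>x\<in>T. b x)
        = (\<Sum>x\<in>S \<inter> E. if x \<in> T then s T else 0)"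
      by (simp add: s_def)
  qed
  also have "\<dots> = (\<Sum>x\<in>S \<inter> E. \<Sum>T\<in>Pow S. if x \<in> T then s T else 0)"
    by (rule sum.swap)
  also have "\<dots> = (\<Sum>x\<in>S \<inter> E. b x * (\<Prod>v\<in>S-{x}. 1 - b v))"
  proof (intro sum.cong refl)
    fix x assume x: "x \<in> S \<inter> E"
    have inj: "inj_on (insert x) (Pow (S - {x}))"
      by (auto simp: inj_on_def)
    have im: "{T \<in> Pow S. x \<in> T} = insert x ` Pow (S - {x})"
    proof (intro equalityI subsetI)
      fix T assume "T \<in> {T \<in> Pow S. x \<in> T}"
      then have "T = insert x (T - {x})" "T - {x} \<in> Pow (S - {x})" by auto
      then show "T \<in> insert x ` Pow (S - {x})" by blast
    qed (use x in auto)
    have "(\<Sum>T\<in>Pow S. if x \<in> T then s T else 0) = (\<Sum>T\<in>{T \<in> Pow S. x \<in> T}. s T)"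
      using assms by (intro sum.inter_filter[symmetric]) auto
    also have "\<dots> = (\<Sum>T\<in>Pow (S - {x}). b x * ((-1) ^ card T * (\<Prod>x\<in>T. b x)))"
      unfolding im sum.reindex[OF inj] o_def
    proof (intro sum.cong refl)
      fix T assume "T \<in> Pow (S - {x})"
      then have "finite T" "x \<notin> T"
        using assms finite_subset by auto
      then show "s (insert x T) = b x * ((-1) ^ card T * (\<Prod>x\<in>T. b x))"
        by (simp add: s_def)
    qed
    also have "\<dots> = b x * (\<Prod>v\<in>S-{x}. 1 - b v)"
      using assms by (simp add: prod_one_minus_expand sum_distrib_left)
    finally show "(\<Sum>T\<in>Pow S. if x \<in> T then s T else 0) = b x * (\<Prod>v\<in>S-{x}. 1 - b v)" .
  qed
  finally show ?thesis .
qed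

lemma exp_max_diff_eq:
  assumes "finite S"
  shows "exp_max S c - exp_max (S - E) c
       = (\<Sum>T\<in>Pow S. of_bool (T \<inter> E \<noteq> {}) * ((-1) ^ (card T + 1) * (\<Prod>x\<in>T. c x)) / card T)"
proof -
  have "exp_max (S - E) c = (\<Sum>T\<in>{T \<in> Pow S. T \<inter> E = {}}. (-1) ^ (card T + 1) * (\<Prod>x\<in>T. c x) / card T)"
    unfolding exp_max_def by (intro sum.cong) auto
  also have "\<dots> = (\<Sum>T\<in>Pow S. if T \<inter> E = {} then (-1) ^ (card T + 1) * (\<Prod>x\<in>T. c x) / card T else 0)"
    using assms by (intro sum.inter_filter) auto
  finally show ?thesis
    unfolding exp_max_def by (auto simp: sum_subtractf[symmetric] intro!: sum.cong)
qed

lemma sum_Pow_hitting: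
  fixes b :: "'a \<Rightarrow> real"
  assumes "finite S"
  shows "(\<Sum>T\<in>Pow S. of_bool (T \<inter> E \<noteq> {}) * ((-1) ^ (card T + 1) * (\<Prod>x\<in>T. b x)))
       = (\<Prod>x\<in>S-E. 1 - b x) - (\<Prod>x\<in>S. 1 - b x)"
proof -
  have "(\<Prod>x\<in>S-E. 1 - b x) = (\<Sum>T\<in>{T \<in> Pow S. T \<inter> E = {}}. (-1) ^ card T * (\<Prod>x\<in>T. b x))"
    using assms by (subst prod_one_minus_expand) (auto intro!: sum.cong)
  also have "\<dots> = (\<Sum>T\<in>Pow S. if T \<inter> E = {} then (-1) ^ card T * (\<Prod>x\<in>T. b x) else 0)"
    using assms by (intro sum.inter_filter) auto
  finally show ?thesis
    using assms by (auto simp: prod_one_minus_expand sum_subtractf[symmetric] intro!: sum.cong)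
qed

text \<open>Scaling \<open>c\<close> by \<open>a\<close> and integrating against
  \<open>da / a\<close> turns the difference into an integral of differences of products, and the
  product over \<open>S\<close> merely has further factors in the unit interval.\<close>

lemma exp_max_Diff_le:
  assumes "finite S" and c: "\<And>x. x \<in> S \<Longrightarrow> 0 \<le> c x \<and> c x \<le> 1"
  shows "exp_max (S - E) c \<le> exp_max S c"
proof -
  have "0 \<le> (\<Sum>T\<in>Pow S. of_bool (T \<inter> E \<noteq> {}) * ((-1) ^ (card T + 1) * (\<Prod>x\<in>T. c x)) / card T)"
  proof (rule sum_div_exponent_nonneg)
    fix a :: real assume a: "0 < a" "a < 1"
    have b: "0 \<le> a * c x \<and> a * c x \<le> 1" if "x \<in> S" for x
      using a c[OF that] by (simp add: mult_le_one)
    have eq: "(\<Sum>T\<in>Pow S. of_bool (T \<inter> E \<noteq> {}) * ((-1) ^ (card T + 1) * (\<Prod>x\<in>T. c x)) * a ^ card T)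
      = (\<Sum>T\<in>Pow S. of_bool (T \<inter> E \<noteq> {}) * ((-1) ^ (card T + 1) * (\<Prod>x\<in>T. a * c x)))"
      by (intro sum.cong refl) (simp add: prod.distrib)
    have "(\<Prod>x\<in>S. 1 - a * c x) = (\<Prod>x\<in>S-E. 1 - a * c x) * (\<Prod>x\<in>S\<inter>E. 1 - a * c x)"
      by (rule prod.Int_Diff[OF assms(1), THEN trans]) (rule mult.commute)
    also have "\<dots> \<le> (\<Prod>x\<in>S-E. 1 - a * c x) * 1"
      using b by (intro mult_left_mono prod_le_1 prod_nonneg) auto
    finally show "0 \<le> (\<Sum>T\<in>Pow S. of_bool (T \<inter> E \<noteq> {}) * ((-1) ^ (card T + 1) * (\<Prod>x\<in>T. c x)) * a ^ card T)"
      unfolding eq sum_Pow_hitting[OF assms(1)] by simp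
  next
    fix T assume "T \<in> Pow S" "card T = 0"
    then have "T = {}"
      using assms(1) finite_subset[of T S] by auto
    then show "of_bool (T \<inter> E \<noteq> {}) * ((-1) ^ (card T + 1) * (\<Prod>x\<in>T. c x)) = 0"
      by simp
  qed (use assms in auto)
  then show ?thesis
    using exp_max_diff_eq[OF assms(1), of c E] by simp
qed

lemma exp_max_nonneg:
  assumes "finite S" and c: "\<And>x. x \<in> S \<Longrightarrow> 0 \<le> c x \<and> c x \<le> 1"
  shows "0 \<le> exp_max S c"
  using exp_max_Diff_le[of S c S] assms by (simp add: exp_max_def)

text \<open>At scale \<open>a\<close> the integrand of the difference is the chance of no event in
  \<open>S - E\<close>, times the excess of "at least one" over "exactly one" event in
  \<open>S \<inter> E\<close>.\<close>

lemma exp_max_diff_ge: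
  fixes c :: "'a \<Rightarrow> real"
  assumes "finite S" and c: "\<And>x. x \<in> S \<Longrightarrow> 0 \<le> c x \<and> c x \<le> 1"
  shows "(\<Sum>T\<in>Pow S. (-1) ^ (card T + 1) * card (T \<inter> E) * (\<Prod>x\<in>T. c x) / card T)
       \<le> exp_max S c - exp_max (S - E) c"
proof -
  define \<kappa> :: "'a set \<Rightarrow> real" where "\<kappa> T = of_bool (T \<inter> E \<noteq> {}) * ((-1) ^ (card T + 1) * (\<Prod>x\<in>T. c x))
     - (-1) ^ (card T + 1) * card (T \<inter> E) * (\<Prod>x\<in>T. c x)" for T :: "'a set"
  have "0 \<le> (\<Sum>T\<in>Pow S. \<kappa> T / card T)"
  proof (rule sum_div_exponent_nonneg)
    fix a :: real assume a: "0 < a" "a < 1"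
    define b where "b x = a * c x" for x
    have b: "0 \<le> b x \<and> b x \<le> 1" if "x \<in> S" for x
      using a c[OF that] by (simp add: mult_le_one b_def)
    have "(\<Sum>T\<in>Pow S. \<kappa> T * a ^ card T)
      = (\<Sum>T\<in>Pow S. of_bool (T \<inter> E \<noteq> {}) * ((-1) ^ (card T + 1) * (\<Prod>x\<in>T. b x)))
       - (\<Sum>T\<in>Pow S. (-1) ^ (card T + 1) * card (T \<inter> E) * (\<Prod>x\<in>T. b x))"
      unfolding sum_subtractf[symmetric]
      by (intro sum.cong refl) (simp add: prod.distrib b_def \<kappa>_def algebra_simps)
    also have "\<dots> = (\<Prod>x\<in>S-E. 1 - b x) - (\<Prod>x\<in>S. 1 - b x) - (\<Sum>x\<in>S \<inter> E. b x * (\<Prod>v\<in>S-{x}. 1 - b v))"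
      by (simp only: sum_Pow_hitting[OF assms(1)] sum_Pow_card_Int[OF assms(1)])
    also have "(\<Prod>x\<in>S. 1 - b x) = (\<Prod>x\<in>S-E. 1 - b x) * (\<Prod>x\<in>S\<inter>E. 1 - b x)"
      by (rule prod.Int_Diff[OF assms(1), THEN trans]) (rule mult.commute)
    also have "(\<Sum>x\<in>S \<inter> E. b x * (\<Prod>v\<in>S-{x}. 1 - b v))
        = (\<Prod>x\<in>S-E. 1 - b x) * (\<Sum>x\<in>S \<inter> E. b x * (\<Prod>v\<in>S\<inter>E-{x}. 1 - b v))"
      unfolding sum_distrib_left
    proof (intro sum.cong refl)
      fix x assume "x \<in> S \<inter> E"
      then have "(\<Prod>v\<in>S-{x}. 1 - b v) = (\<Prod>x\<in>S-E. 1 - b x) * (\<Prod>v\<in>S\<inter>E-{x}. 1 - b v)"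
        using assms(1) by (subst prod.union_disjoint[symmetric]) (auto intro!: prod.cong)
      then show "b x * (\<Prod>v\<in>S-{x}. 1 - b v)
          = (\<Prod>x\<in>S-E. 1 - b x) * (b x * (\<Prod>v\<in>S\<inter>E-{x}. 1 - b v))"
        by simp
    qed
    finally have eq: "(\<Sum>T\<in>Pow S. \<kappa> T * a ^ card T) = (\<Prod>x\<in>S-E. 1 - b x) *
        (1 - (\<Prod>x\<in>S\<inter>E. 1 - b x) - (\<Sum>x\<in>S \<inter> E. b x * (\<Prod>v\<in>S\<inter>E-{x}. 1 - b v)))"
      by (simp add: algebra_simps)
    have "(\<Sum>x\<in>S \<inter> E. b x * (\<Prod>v\<in>S\<inter>E-{x}. 1 - b v)) \<le> 1 - (\<Prod>x\<in>S\<inter>E. 1 - b x)"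
      using assms(1) b by (intro exactly_one_le_at_least_one) auto
    then show "0 \<le> (\<Sum>T\<in>Pow S. \<kappa> T * a ^ card T)"
      unfolding eq using b by (intro mult_nonneg_nonneg prod_nonneg) auto
  next
    fix T assume "T \<in> Pow S" "card T = 0"
    then have "T = {}"
      using assms(1) finite_subset[of T S] by auto
    then show "\<kappa> T = 0"
      by (simp add: \<kappa>_def)
  qed (use assms in auto)
  then show ?thesis
    unfolding exp_max_diff_eq[OF assms(1)] \<kappa>_def by (simp add: sum_subtractf diff_divide_distrib sum_negf)
qed

text \<open>Pathwise, lowering all shifts by \<open>- ln r\<close> lowers a maximum with 0 by at
  most \<open>- ln r\<close>. Analytically, the right side has derivative
  \<open>- (\<Prod>x\<in>S. 1 - r * c x) / r\<close> in \<open>r\<close>, which is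
  nonpositive.\<close>

lemma exp_max_le_scaled:
  assumes "finite S" and c: "\<And>x. x \<in> S \<Longrightarrow> 0 \<le> c x \<and> c x \<le> 1" and r: "0 < r" "r \<le> 1"
  shows "exp_max S c \<le> exp_max S (\<lambda>x. r * c x) - ln r"
proof -
  define F where "F a = exp_max S (\<lambda>x. a * c x) - ln a" for a :: real
  have "F 1 \<le> F r"
  proof (rule DERIV_nonpos_imp_nonincreasing[OF r(2)])
    fix a :: real assume a: "r \<le> a" "a \<le> 1"
    then have a0: "0 < a" using r by simp
    let ?d = "\<Sum>T\<in>Pow S. if T = {} then 0 else (-1) ^ (card T + 1) * (\<Prod>x\<in>T. c x) * a ^ (card T - 1)"
    have "((\<lambda>a. exp_max S (\<lambda>x. a * c x)) has_real_derivative ?d) (at a)"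
      unfolding exp_max_def
    proof (intro DERIV_sum)
      fix T assume "T \<in> Pow S"
      then have "finite T" using assms(1) finite_subset by auto
      then have "T = {} \<or> real (card T) \<noteq> 0" by simp
      then show "((\<lambda>a. (-1) ^ (card T + 1) * (\<Prod>x\<in>T. a * c x) / real (card T)) has_real_derivative
           (if T = {} then 0 else (-1) ^ (card T + 1) * (\<Prod>x\<in>T. c x) * a ^ (card T - 1))) (at a)"
        unfolding prod.distrib
        by (cases "T = {}") (auto intro!: derivative_eq_intros)
    qed
    then have der: "(F has_real_derivative ?d - 1 / a) (at a)"
      unfolding F_def using a0 by (auto intro!: derivative_eq_intros)
    have "a * ?d = 1 - (\<Sum>T\<in>Pow S. (-1) ^ card T * (\<Prod>x\<in>T. a * c x))"
    proof -
      have "a * ?d = (\<Sum>T\<in>Pow S. (if T = {} then 1 else 0) - (-1) ^ card T * (\<Prod>x\<in>T. a * c x))"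
        unfolding sum_distrib_left
      proof (intro sum.cong refl)
        fix T assume "T \<in> Pow S"
        then have "finite T" using assms(1) finite_subset by auto
        then have "T \<noteq> {} \<Longrightarrow> a * a ^ (card T - 1) = a ^ card T"
          by (cases "card T") auto
        then show "a * (if T = {} then 0 else (-1) ^ (card T + 1) * (\<Prod>x\<in>T. c x) * a ^ (card T - 1))
            = (if T = {} then 1 else 0) - (-1) ^ card T * (\<Prod>x\<in>T. a * c x)"
          by (auto simp: prod.distrib)
      qed
      then show ?thesis
        using assms(1) by (simp add: sum_subtractf)
    qed
    also have "\<dots> = 1 - (\<Prod>x\<in>S. 1 - a * c x)"
      using prod_one_minus_expand[OF assms(1), of "\<lambda>x. a * c x"] by simp
    also have "\<dots> \<le> 1"
      using a0 a c by (auto intro!: prod_nonneg mult_le_one)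
    finally have "?d - 1 / a \<le> 0"
      using a0 by (simp add: field_simps)
    then show "\<exists>y. (F has_real_derivative y) (at a) \<and> y \<le> 0"
      using der by blast
  qed
  then show ?thesis by (simp add: F_def)
qed

lemma exp_max_one:
  assumes "finite S"
  shows "exp_max S (\<lambda>_. 1) = harm (card S)"
  using assms
proof (induction S)
  case empty
  then show ?case by (simp add: exp_max_def harm_def)
next
  case (insert a S)
  define m where "m = card S"
  have inj: "inj_on (insert a) (Pow S)"
    using insert.hyps by (auto simp: inj_on_def)
  \<comment> \<open>The sets containing \<open>a\<close> contribute the integral of
    \<open>(1 - r) ^ m\<close> over the unit interval. \<open>F\<close> is the difference of two
    antiderivatives of that integrand, hence constant, and comparing it at 0 and 1 gives
    \<open>1 / (m + 1)\<close>.\<close>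
  define F where "F r = (\<Sum>T\<in>Pow S. (-1) ^ card T * r ^ (card T + 1) / (card T + 1)) + (1 - r) ^ (m + 1) / (m + 1)"
    for r :: real
  have "(F has_real_derivative 0) (at r)" for r
  proof -
    have "((\<lambda>r. (-1) ^ card T * r ^ (card T + 1) / real (card T + 1)) has_real_derivative
        (-1) ^ card T * r ^ card T) (at r)" for T :: "'a set"
      using DERIV_cdivide[OF DERIV_cmult[OF DERIV_pow[of "card T + 1" r], of "(-1) ^ card T"], of "real (card T + 1)"]
      by (simp add: field_simps del: of_nat_Suc of_nat_add)
    then have sum: "((\<lambda>r. \<Sum>T\<in>Pow S. (-1) ^ card T * r ^ (card T + 1) / real (card T + 1))
        has_real_derivative (\<Sum>T\<in>Pow S. (-1) ^ card T * r ^ card T)) (at r)"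
      by (rule DERIV_sum)
    have "((\<lambda>r. 1 - r) has_real_derivative - 1) (at r)"
      by (auto intro!: derivative_eq_intros)
    from DERIV_power[OF this, of "m + 1"]
    have "((\<lambda>r. (1 - r) ^ (m + 1)) has_real_derivative - (real (m + 1) * (1 - r) ^ m)) (at r)"
      by (simp add: algebra_simps)
    from DERIV_cdivide[OF this, of "real (m + 1)"]
    have "((\<lambda>r. (1 - r) ^ (m + 1) / real (m + 1)) has_real_derivative - ((1 - r) ^ m)) (at r)"
      by (simp add: field_simps del: of_nat_Suc of_nat_add)
    from DERIV_add[OF sum this]
    have "(F has_real_derivative (\<Sum>T\<in>Pow S. (-1) ^ card T * r ^ card T) - (1 - r) ^ m) (at r)"
      unfolding F_def by simp
    moreover have "(\<Sum>T\<in>Pow S. (-1) ^ card T * r ^ card T) = (1 - r) ^ m"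
      using prod_one_minus_expand[OF insert.hyps(1), of "\<lambda>_. r"] by (simp add: m_def)
    ultimately show ?thesis by simp
  qed
  then have "F 1 = F 0"
    by (intro DERIV_isconst_all) auto
  then have F: "(\<Sum>T\<in>Pow S. (-1) ^ card T / (card T + 1)) = 1 / real (m + 1)"
    by (simp add: F_def)
  have "exp_max (insert a S) (\<lambda>_. 1) = exp_max S (\<lambda>_. 1) + (\<Sum>T\<in>insert a ` Pow S. (-1) ^ (card T + 1) / card T)"
    unfolding exp_max_def Pow_insert using insert.hyps by (subst sum.union_disjoint) auto
  also have "(\<Sum>T\<in>insert a ` Pow S. (-1) ^ (card T + 1) / real (card T)) = (\<Sum>T\<in>Pow S. (-1) ^ card T / (card T + 1))"
    unfolding sum.reindex[OF inj] o_def
  proof (intro sum.cong refl)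
    fix T assume "T \<in> Pow S"
    then have "finite T" "a \<notin> T"
      using insert.hyps finite_subset by auto
    then show "(-1) ^ (card (insert a T) + 1) / real (card (insert a T)) = (-1) ^ card T / (card T + 1)"
      by (simp add: add.commute)
  qed
  finally show ?case
    using insert F by (simp add: harm_Suc m_def inverse_eq_divide add.commute)
qed

text \<open>The boundary condition lies at infinity: \<open>exp (- A * s) * D s\<close> is
  nonincreasing, and the lower bound on \<open>D\<close> keeps it above a function tending to 0, so
  it is never negative.\<close>

lemma nonneg_if_deriv_le_mult:
  fixes D D' :: "real \<Rightarrow> real"
  assumes der: "\<And>t. t \<ge> 0 \<Longrightarrow> (D has_real_derivative D' t) (at t)"
    and le: "\<And>t. t \<ge> 0 \<Longrightarrow> D' t \<le> A * D t"
    and bdd: "\<And>t. t \<ge> 0 \<Longrightarrow> - B \<le> D t"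
    and "A > 0" "t \<ge> 0"
  shows "0 \<le> D t"
proof -
  define N where "N s = exp (- A * s) * D s" for s
  have anti: "N s \<le> N t" if "t \<le> s" for s
  proof (rule DERIV_nonpos_imp_nonincreasing[OF that])
    fix r assume "t \<le> r" "r \<le> s"
    then have "r \<ge> 0" using assms by simp
    have "(N has_real_derivative exp (- A * r) * (D' r - A * D r)) (at r)"
      unfolding N_def using der[OF \<open>r \<ge> 0\<close>]
      by (auto intro!: derivative_eq_intros simp: algebra_simps)
    moreover have "exp (- A * r) * (D' r - A * D r) \<le> 0"
      using le[OF \<open>r \<ge> 0\<close>] by (simp add: mult_nonneg_nonpos)
    ultimately show "\<exists>y. (N has_real_derivative y) (at r) \<and> y \<le> 0" by blast
  qed
  have "((\<lambda>s. exp (- A * s)) \<longlongrightarrow> 0) at_top"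
    using \<open>A > 0\<close>
    by (intro filterlim_compose[OF exp_at_bot] filterlim_tendsto_neg_mult_at_bot[OF tendsto_const])
       (auto simp: filterlim_ident)
  then have "((\<lambda>s. exp (- A * s) * - B) \<longlongrightarrow> 0 * - B) at_top"
    by (intro tendsto_intros)
  moreover have "eventually (\<lambda>s. exp (- A * s) * - B \<le> N t) at_top"
    using eventually_ge_at_top[of t]
  proof eventually_elim
    case (elim s)
    have "exp (- A * s) * - B \<le> N s"
      unfolding N_def using bdd[of s] elim \<open>t \<ge> 0\<close> by (intro mult_left_mono) auto
    then show ?case using anti[OF elim] by simp
  qed
  ultimately have "0 \<le> N t"
    using tendsto_upperbound[of "\<lambda>s. exp (- A * s) * - B" 0 at_top "N t"] by simp
  then show ?thesis
    by (simp add: N_def zero_le_mult_iff)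
qed

section \<open>The cut process and its survivor\<close>

text \<open>Starting from \<open>S\<close>, cuts arrive at rates \<open>z\<close> and the process is killed at rate \<open>\<gamma>\<close>; this is
  the expected integral of the reward rate \<open>\<psi>\<close> up to the killing time.\<close>

function green :: "'a set \<Rightarrow> ('a set \<Rightarrow> real) \<Rightarrow> ('a set \<Rightarrow> real) \<Rightarrow> ('a set \<Rightarrow> real) \<Rightarrow> 'a set \<Rightarrow> real"
  where
  "green U z \<gamma> \<psi> S =
     (if finite S then
        (\<psi> S + (\<Sum>E\<in>crossing U S. z E * green U z \<gamma> \<psi> (S - E))) / (\<gamma> S + (\<Sum>E\<in>crossing U S. z E))
      else 0)"
  by pat_completeness auto
termination
  by (relation "Wellfounded.measure (\<lambda>(U, z, \<gamma>, \<psi>, S). card S)")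
     (auto simp: crossing_def intro!: psubset_card_mono)

declare green.simps [simp del]

text \<open>Killing at rate 1 in singletons only makes the value there \<open>\<phi>\<close>. On
  larger sets crossed at total rate 0, division by zero yields 0, the convention made for
  \<open>f\<close>.\<close>

definition survivor_mean :: "'a set \<Rightarrow> ('a set \<Rightarrow> real) \<Rightarrow> ('a \<Rightarrow> real) \<Rightarrow> 'a set \<Rightarrow> real" where
  "survivor_mean U z \<phi> = green U z (\<lambda>S. of_bool (card S = 1)) (\<lambda>S. of_bool (card S = 1) * \<phi> (the_elem S))"

lemma crossing_empty [simp]: "crossing U {} = {}"
  by (simp add: crossing_def)

lemma crossing_singleton [simp]: "crossing U {x} = {}"
  by (auto simp: crossing_def)

lemma crossing_psubset: "E \<in> crossing U S \<Longrightarrow> S - E \<subset> S" "E \<in> crossing U S \<Longrightarrow> S - E \<noteq> {}"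
  by (auto simp: crossing_def)

lemma crossing_subset: "E \<in> crossing U S \<Longrightarrow> E \<subseteq> U"
  by (auto simp: crossing_def)

lemma finite_crossing [simp]: "finite U \<Longrightarrow> finite (crossing U S)"
  by (rule finite_subset[of _ "Pow U"]) (auto simp: crossing_def)

lemma survivor_mean_singleton [simp]: "survivor_mean U z \<phi> {x} = \<phi> x"
  unfolding survivor_mean_def by (subst green.simps) simp

lemma survivor_mean_empty [simp]: "survivor_mean U z \<phi> {} = 0"
  unfolding survivor_mean_def by (subst green.simps) simp

lemma survivor_mean_rec:
  assumes "finite S" "card S \<noteq> 1"
  shows "survivor_mean U z \<phi> S = (\<Sum>E\<in>crossing U S. z E * survivor_mean U z \<phi> (S - E)) / (\<Sum>E\<in>crossing U S. z E)"
  unfolding survivor_mean_def by (subst green.simps) (use assms in simp)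

lemma rtf_eq_survivor_mean: "finite S \<Longrightarrow> rtf U z S = survivor_mean U z (ell U z) S"
proof (induction S rule: finite_psubset_induct)
  case (psubset S)
  consider "S = {}" | x where "S = {x}" | "card S \<ge> 2"
    using psubset.hyps by (metis One_nat_def Suc_1 card_1_singletonE card_eq_0_iff less_2_cases not_less)
  then show ?case
  proof cases
    case 3
    have "(\<Sum>E\<in>crossing U S. z E * rtf U z (S - E)) = (\<Sum>E\<in>crossing U S. z E * survivor_mean U z (ell U z) (S - E))"
      by (intro sum.cong) (simp_all add: psubset.IH crossing_psubset(1) del: rtf.simps)
    then show ?thesis
      using 3 psubset.hyps by (subst rtf.simps) (simp add: survivor_mean_rec del: rtf.simps)
  next
    case 1
    then show ?thesis by (subst rtf.simps) (simp del: rtf.simps)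
  next
    case 2
    then show ?thesis by (subst rtf.simps) (simp del: rtf.simps)
  qed
qed

lemma survivor_mean_add:
  "finite S \<Longrightarrow> survivor_mean U z (\<lambda>x. \<phi> x + \<eta> x) S = survivor_mean U z \<phi> S + survivor_mean U z \<eta> S"
proof (induction S rule: finite_psubset_induct)
  case (psubset S)
  show ?case
  proof (cases "card S = 1")
    case True
    then obtain x where "S = {x}" by (rule card_1_singletonE)
    then show ?thesis by simp
  next
    case False
    have "(\<Sum>E\<in>crossing U S. z E * survivor_mean U z (\<lambda>x. \<phi> x + \<eta> x) (S - E))
        = (\<Sum>E\<in>crossing U S. z E * survivor_mean U z \<phi> (S - E) + z E * survivor_mean U z \<eta> (S - E))"
      by (intro sum.cong) (simp_all add: psubset.IH crossing_psubset(1) distrib_left)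
    then show ?thesis
      using False psubset.hyps by (simp add: survivor_mean_rec sum.distrib add_divide_distrib)
  qed
qed

section \<open>Lifetime of the survivor against a thinned family of cuts\<close>

locale cut_family =
  fixes U :: "'a set" and z y :: "'a set \<Rightarrow> real"
  assumes finU: "finite U"
    and y_nonneg: "E \<subseteq> U \<Longrightarrow> 0 \<le> y E"
    and y_le_z: "E \<subseteq> U \<Longrightarrow> y E \<le> z E"
begin

lemma z_nonneg: "E \<subseteq> U \<Longrightarrow> 0 \<le> z E"
  using y_nonneg[of E] y_le_z[of E] by simp

definition cross_rate :: "'a set \<Rightarrow> real" where
  "cross_rate S = (\<Sum>E\<in>crossing U S. z E)"

lemma cross_rate_nonneg: "0 \<le> cross_rate S"
  unfolding cross_rate_def by (intro sum_nonneg z_nonneg crossing_subset)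

lemma cross_rate_eq_0D: "cross_rate S = 0 \<Longrightarrow> E \<in> crossing U S \<Longrightarrow> z E = 0"
  using sum_nonneg_eq_0_iff[of "crossing U S" z] z_nonneg[OF crossing_subset] finU
  by (simp add: cross_rate_def)

text \<open>The product form also covers the degenerate cases: a singleton has no crossing cut, and
  total rate 0 forces every crossing \<open>z E\<close> to vanish.\<close>

lemma cross_rate_survivor_mean:
  assumes "finite S"
  shows "cross_rate S * survivor_mean U z \<phi> S = (\<Sum>E\<in>crossing U S. z E * survivor_mean U z \<phi> (S - E))"
proof (cases "cross_rate S = 0 \<or> card S = 1")
  case True
  then show ?thesis
  proof
    assume "card S = 1"
    then obtain x where "S = {x}" by (rule card_1_singletonE)
    then show ?thesis by (simp add: cross_rate_def)
  qed (simp add: cross_rate_eq_0D)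
next
  case False
  then show ?thesis
    using assms by (simp add: survivor_mean_rec cross_rate_def)
qed

text \<open>Induction through weighted averages; \<open>0 \<le> M\<close> takes care of the default
  value 0.\<close>

lemma survivor_mean_le:
  assumes "finite S" "0 \<le> M" "\<And>x. x \<in> S \<Longrightarrow> \<phi> x \<le> M"
  shows "survivor_mean U z \<phi> S \<le> M"
  using assms
proof (induction S rule: finite_psubset_induct)
  case (psubset S)
  show ?case
  proof (cases "cross_rate S = 0 \<or> card S = 1")
    case True
    then show ?thesis
    proof (cases "card S = 1")
      case True
      then obtain x where "S = {x}" by (rule card_1_singletonE)
      then show ?thesis using psubset.prems by simp
    next
      case False
      then show ?thesis
        using \<open>cross_rate S = 0 \<or> card S = 1\<close> psubset by (simp add: survivor_mean_rec cross_rate_def)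
    qed
  next
    case False
    then have pos: "cross_rate S > 0"
      using cross_rate_nonneg[of S] by simp
    have "cross_rate S * survivor_mean U z \<phi> S \<le> (\<Sum>E\<in>crossing U S. z E * M)"
      unfolding cross_rate_survivor_mean[OF psubset.hyps]
    proof (intro sum_mono mult_left_mono)
      fix E assume E: "E \<in> crossing U S"
      show "survivor_mean U z \<phi> (S - E) \<le> M"
        using psubset.prems by (intro psubset.IH crossing_psubset(1)[OF E]) auto
      show "0 \<le> z E"
        using E by (intro z_nonneg crossing_subset)
    qed
    then have "cross_rate S * survivor_mean U z \<phi> S \<le> cross_rate S * M"
      by (simp add: cross_rate_def sum_distrib_right)
    then show ?thesis using pos by (simp add: mult_le_cancel_left_pos)
  qed
qed

lemma green_nonneg:
  assumes "finite S" "\<And>T. T \<subseteq> S \<Longrightarrow> 0 \<le> \<gamma> T" "\<And>T. T \<subseteq> S \<Longrightarrow> 0 \<le> \<psi> T"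
  shows "0 \<le> green U z \<gamma> \<psi> S"
  using assms
proof (induction S rule: finite_psubset_induct)
  case (psubset S)
  have "0 \<le> z E * green U z \<gamma> \<psi> (S - E)" if "E \<in> crossing U S" for E
    using that psubset z_nonneg[OF crossing_subset[OF that]] crossing_psubset(1)[OF that]
    by (intro mult_nonneg_nonneg psubset.IH) auto
  moreover have "0 \<le> \<gamma> S" "0 \<le> \<psi> S" "0 \<le> cross_rate S"
    using psubset.prems cross_rate_nonneg by auto
  ultimately show ?case
    by (subst green.simps) (auto intro!: divide_nonneg_nonneg add_nonneg_nonneg sum_nonneg simp: cross_rate_def)
qed

text \<open>A cut containing all of \<open>S\<close> hits the survivor whichever point of
  \<open>S\<close> it will be, so this is the killing rate in state \<open>S\<close>.\<close>

definition cover_rate :: "'a set \<Rightarrow> real" where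
  "cover_rate S = (\<Sum>E\<in>{E. E \<subseteq> U \<and> S \<subseteq> E}. y E)"

abbreviation mean_ell :: "'a set \<Rightarrow> real" where
  "mean_ell \<equiv> survivor_mean U z (ell U y)"

text \<open>The expectation of \<open>ell U y X * T\<close>, where \<open>X\<close> is the survivor and \<open>T\<close> the first time
  a \<open>y\<close>-cut contains \<open>X\<close>.\<close>

abbreviation scaled_life :: "'a set \<Rightarrow> real" where
  "scaled_life \<equiv> green U z cover_rate mean_ell"

lemma cover_rate_nonneg: "0 \<le> cover_rate S"
  unfolding cover_rate_def using y_nonneg by (intro sum_nonneg) auto

lemma ell_y_nonneg: "0 \<le> ell U y x"
  unfolding ell_def using y_nonneg by (intro sum_nonneg) auto

lemma mean_ell_nonneg: "finite S \<Longrightarrow> 0 \<le> mean_ell S"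
  unfolding survivor_mean_def by (intro green_nonneg) (auto simp: ell_y_nonneg)

lemma scaled_life_nonneg: "finite S \<Longrightarrow> 0 \<le> scaled_life S"
  by (intro green_nonneg) (auto simp: cover_rate_nonneg intro: mean_ell_nonneg finite_subset)

lemma scaled_life_empty [simp]: "scaled_life {} = 0"
  by (subst green.simps) simp

text \<open>For a singleton the covering cuts are exactly those counted by \<open>ell\<close>; any
  other set crossed at rate 0 has the default value 0. This keeps the product form of the recursion
  of \<open>scaled_life\<close> true when its denominator vanishes.\<close>

lemma mean_ell_eq_0:
  assumes "finite S" "cover_rate S + cross_rate S = 0"
  shows "mean_ell S = 0"
proof (cases "card S = 1")
  case True
  then obtain x where "S = {x}" by (rule card_1_singletonE)
  then show ?thesis
    using assms cross_rate_nonneg[of S] cover_rate_nonneg[of S] by (auto simp: cover_rate_def ell_def)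
next
  case False
  then show ?thesis
    using assms cross_rate_nonneg[of S] cover_rate_nonneg[of S] by (simp add: survivor_mean_rec cross_rate_def)
qed

lemma scaled_life_rec:
  assumes "finite S"
  shows "(cover_rate S + cross_rate S) * scaled_life S = mean_ell S + (\<Sum>E\<in>crossing U S. z E * scaled_life (S - E))"
proof (cases "cover_rate S + cross_rate S = 0")
  case True
  then have "cross_rate S = 0"
    using cross_rate_nonneg[of S] cover_rate_nonneg[of S] by simp
  then show ?thesis
    using True mean_ell_eq_0[OF assms] by (simp add: cross_rate_eq_0D)
next
  case False
  then show ?thesis
    using assms by (subst green.simps) (simp add: cross_rate_def)
qed

text \<open>Cut by cut, the inequality says that the probability of at least one event is at least the
  probability of exactly one. The assumption on \<open>x0\<close> makes one factor \<open>1 - c t x\<close> vanish, so that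
  no boundary term appears in the time derivative.\<close>

lemma exp_max_supersolution:
  assumes "finite S" and t: "0 \<le> t" and M: "\<And>x. x \<in> S \<Longrightarrow> ell U y x \<le> M" and x0: "x0 \<in> S" "ell U y x0 = M"
  defines "c \<equiv> \<lambda>t x. exp (- (M - ell U y x) * t)"
  obtains d where "((\<lambda>t. exp_max S (c t)) has_real_derivative d) (at t)"
    and "(\<Sum>E\<in>crossing U S. z E * exp_max (S - E) (c t)) \<le> (cover_rate S + cross_rate S) * exp_max S (c t) - M - d"
proof -
  define h where "h T = (-1) ^ (card T + 1) * (\<Prod>x\<in>T. c t x) / card T" for T
  define l where "l T = (\<Sum>x\<in>T. ell U y x)" for T
  define d where "d = (\<Sum>T\<in>Pow S. h T * - (M * card T - l T))"
  have c: "0 \<le> c t x \<and> c t x \<le> 1" if "x \<in> S" for x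
    using M[OF that] t by (auto simp: c_def mult_nonpos_nonneg)
  have finT: "finite T" if "T \<in> Pow S" for T
    using that assms(1) finite_subset by auto
  have prod_c: "(\<Prod>x\<in>T. c s x) = exp (- (M * card T - l T) * s)" if "T \<in> Pow S" for T s
    using finT[OF that]
    by (simp add: c_def exp_sum[symmetric] sum_distrib_right[symmetric] sum_subtractf l_def sum_negf)
  have der: "((\<lambda>t. exp_max S (c t)) has_real_derivative d) (at t)"
    unfolding exp_max_def d_def
  proof (intro DERIV_sum)
    fix T assume T: "T \<in> Pow S"
    show "((\<lambda>t. (-1) ^ (card T + 1) * (\<Prod>x\<in>T. c t x) / card T) has_real_derivative
        h T * - (M * card T - l T)) (at t)"
    proof -
      let ?k = "M * card T - l T"
      have "((\<lambda>t. exp (- ?k * t)) has_real_derivative exp (- ?k * t) * - ?k) (at t)"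
        by (auto intro!: derivative_eq_intros)
      from DERIV_cdivide[OF DERIV_cmult[OF this, of "(-1) ^ (card T + 1)"], of "real (card T)"]
      show ?thesis
        by (simp add: h_def prod_c[OF T] mult.assoc)
    qed
  qed
  have full: "(\<Sum>T\<in>Pow S. h T * card T) = 1"
  proof -
    have "(\<Sum>T\<in>Pow S. h T * card T) = (\<Sum>T\<in>Pow S. (if T = {} then 1 else 0) - (-1) ^ card T * (\<Prod>x\<in>T. c t x))"
    proof (intro sum.cong refl)
      fix T assume "T \<in> Pow S"
      then have "T = {} \<or> card T \<noteq> 0" using finT by auto
      then show "h T * card T = (if T = {} then 1 else 0) - (-1) ^ card T * (\<Prod>x\<in>T. c t x)"
        by (auto simp: h_def)
    qed
    also have "\<dots> = 1 - (\<Prod>x\<in>S. 1 - c t x)"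
      using assms(1) by (simp add: sum_subtractf prod_one_minus_expand)
    also have "(\<Prod>x\<in>S. 1 - c t x) = 0"
      using assms(1) x0 by (intro prod_zero bexI[of _ x0]) (auto simp: c_def)
    finally show ?thesis by simp
  qed
  have l: "l T = (\<Sum>E\<in>Pow U. y E * card (T \<inter> E))" if "T \<in> Pow S" for T
  proof -
    have "l T = (\<Sum>x\<in>T. \<Sum>E\<in>Pow U. if x \<in> E then y E else 0)"
      unfolding l_def ell_def using finU
      by (intro sum.cong[OF refl, of T]) (simp add: sum.inter_filter[symmetric])
    also have "\<dots> = (\<Sum>E\<in>Pow U. \<Sum>x\<in>T. if x \<in> E then y E else 0)"
      by (rule sum.swap)
    also have "\<dots> = (\<Sum>E\<in>Pow U. y E * card (T \<inter> E))"
      using finT[OF that] by (intro sum.cong[OF refl, of "Pow U"]) (simp add: sum.inter_restrict[symmetric])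
    finally show ?thesis .
  qed
  define I where "I T = exp_max T (c t)" for T
  have I0: "I {} = 0" by (simp add: I_def exp_max_def)
  \<comment> \<open>By \<open>full\<close>, the terms of \<open>d\<close> that carry
    \<open>M\<close> add up to \<open>- M\<close>. What is left is distributed over the individual
    cuts by double counting \<open>l T\<close>.\<close>
  have "M + d = (\<Sum>T\<in>Pow S. h T * l T)"
  proof -
    have "d = (\<Sum>T\<in>Pow S. h T * l T - M * (h T * card T))"
      unfolding d_def by (rule sum.cong) (simp_all add: algebra_simps)
    also have "\<dots> = (\<Sum>T\<in>Pow S. h T * l T) - M * (\<Sum>T\<in>Pow S. h T * card T)"
      by (simp only: sum_subtractf sum_distrib_left)
    finally show ?thesis using full by simp
  qed
  also have "\<dots> = (\<Sum>T\<in>Pow S. \<Sum>E\<in>Pow U. y E * (h T * card (T \<inter> E)))"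
    by (intro sum.cong refl) (simp add: l sum_distrib_left mult_ac)
  also have "\<dots> = (\<Sum>E\<in>Pow U. y E * (\<Sum>T\<in>Pow S. h T * card (T \<inter> E)))"
    by (subst sum.swap) (simp add: sum_distrib_left)
  also have "\<dots> \<le> (\<Sum>E\<in>Pow U. y E * (I S - I (S - E)))"
  proof (intro sum_mono mult_left_mono)
    fix E
    have "(\<Sum>T\<in>Pow S. h T * card (T \<inter> E))
        = (\<Sum>T\<in>Pow S. (-1) ^ (card T + 1) * card (T \<inter> E) * (\<Prod>x\<in>T. c t x) / card T)"
      by (intro sum.cong refl) (simp add: h_def)
    also have "\<dots> \<le> I S - I (S - E)"
      unfolding I_def by (intro exp_max_diff_ge assms c)
    finally show "(\<Sum>T\<in>Pow S. h T * card (T \<inter> E)) \<le> I S - I (S - E)" .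
  qed (use y_nonneg in auto)
  \<comment> \<open>A cut that neither crosses nor covers \<open>S\<close> misses it, so its term is
    0.\<close>
  also have "\<dots> = (\<Sum>E\<in>crossing U S. y E * (I S - I (S - E)))
      + (\<Sum>E\<in>{E. E \<subseteq> U \<and> S \<subseteq> E}. y E * (I S - I (S - E)))"
  proof -
    have "(\<Sum>E\<in>Pow U. y E * (I S - I (S - E)))
        = (\<Sum>E\<in>crossing U S \<union> {E. E \<subseteq> U \<and> S \<subseteq> E}. y E * (I S - I (S - E)))"
    proof (intro sum.mono_neutral_right ballI)
      fix E assume "E \<in> Pow U - (crossing U S \<union> {E. E \<subseteq> U \<and> S \<subseteq> E})"
      then have "S - E = S" by (auto simp: crossing_def)
      then show "y E * (I S - I (S - E)) = 0" by simp
    qed (use finU in \<open>auto simp: crossing_def\<close>)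
    then show ?thesis
      using finU by (subst (asm) sum.union_disjoint) (auto simp: crossing_def)
  qed
  \<comment> \<open>On crossing cuts \<open>y\<close> may be raised to \<open>z\<close> because
    \<open>exp_max\<close> is monotone in the set; for covering cuts \<open>S - E\<close> is
    empty.\<close>
  also have "\<dots> \<le> (\<Sum>E\<in>crossing U S. z E * (I S - I (S - E))) + (\<Sum>E\<in>{E. E \<subseteq> U \<and> S \<subseteq> E}. y E * I S)"
  proof (intro add_mono sum_mono)
    fix E assume "E \<in> crossing U S"
    then have "y E \<le> z E"
      by (intro y_le_z crossing_subset)
    then show "y E * (I S - I (S - E)) \<le> z E * (I S - I (S - E))"
      using exp_max_Diff_le[of S "c t" E] assms(1) c by (intro mult_right_mono) (auto simp: I_def)
  next
    fix E assume "E \<in> {E. E \<subseteq> U \<and> S \<subseteq> E}"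
    then have "S - E = {}" by auto
    then show "y E * (I S - I (S - E)) \<le> y E * I S"
      by (simp only: I0 diff_zero order.refl)
  qed
  also have "\<dots> = (cover_rate S + cross_rate S) * I S - (\<Sum>E\<in>crossing U S. z E * I (S - E))"
    by (simp add: cover_rate_def cross_rate_def algebra_simps sum_subtractf sum_distrib_left)
  finally show ?thesis
    by (intro that[OF der]) (simp add: I_def)
qed

text \<open>For the survivor \<open>X\<close> and \<open>T\<close> as above, \<open>ell U y X * (t + T)\<close> is compared with the maximum
  over \<open>x \<in> S\<close> of \<open>ell U y x * t + e\<^sub>x\<close> with independent exponential \<open>e\<^sub>x\<close>.\<close>

lemma scaled_life_potential:
  assumes "finite S" "S \<noteq> {}" "\<And>x. x \<in> S \<Longrightarrow> ell U y x \<le> M" "0 \<le> t"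
  shows "scaled_life S + t * mean_ell S \<le> M * t + exp_max S (\<lambda>x. exp (- (M - ell U y x) * t))"
  using assms
proof (induction S arbitrary: M t rule: finite_psubset_induct)
  case (psubset S)
  \<comment> \<open>The supersolution needs a level attained in \<open>S\<close>, so the claim is
    first shown at level \<open>m\<close>; the level \<open>M\<close> is restored at the
    end.\<close>
  define m where "m = Max (ell U y ` S)"
  have m_ge: "ell U y x \<le> m" if "x \<in> S" for x
    unfolding m_def using that psubset.hyps by simp
  have "m \<in> ell U y ` S"
    unfolding m_def using psubset by (intro Max_in) auto
  then obtain x0 where x0: "x0 \<in> S" "ell U y x0 = m" by auto
  have m0: "0 \<le> m" using x0 ell_y_nonneg by metis
  have fm: "mean_ell S \<le> m"
    using psubset.hyps m0 m_ge by (rule survivor_mean_le)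
  define c where "c t x = exp (- (m - ell U y x) * t)" for t x
  define A where "A = cover_rate S + cross_rate S"
  define D where "D t = m * t + exp_max S (c t) - scaled_life S - t * mean_ell S" for t
  have c01: "0 \<le> c s x \<and> c s x \<le> 1" if "x \<in> S" "0 \<le> s" for s x
    using that m_ge by (auto simp: c_def mult_nonpos_nonneg)
  have exp_max0: "0 \<le> exp_max S (c s)" if "0 \<le> s" for s
    using that psubset.hyps c01 by (intro exp_max_nonneg) auto
  have D_nonneg: "0 \<le> D t" if "0 \<le> t" for t
  proof (cases "A = 0")
    case True
    then have "mean_ell S = 0"
      using mean_ell_eq_0[OF psubset.hyps] by (simp add: A_def)
    moreover from True have "scaled_life S = 0"
      by (subst green.simps) (simp add: A_def cross_rate_def)
    ultimately show ?thesis
      using exp_max0[OF that] m0 that by (simp add: D_def)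
  next
    case False
    then have "A > 0"
      using cross_rate_nonneg[of S] cover_rate_nonneg[of S] by (simp add: A_def)
    have "\<exists>d. (D has_real_derivative d) (at s) \<and> d \<le> A * D s" if s: "0 \<le> s" for s
    proof -
      obtain d where d: "((\<lambda>t. exp_max S (c t)) has_real_derivative d) (at s)"
        and le: "(\<Sum>E\<in>crossing U S. z E * exp_max (S - E) (c s)) \<le> A * exp_max S (c s) - m - d"
        unfolding c_def A_def by (rule exp_max_supersolution[OF psubset.hyps s m_ge x0])
      have der: "(D has_real_derivative m + d - mean_ell S) (at s)"
        unfolding D_def using d by (auto intro!: derivative_eq_intros)
      \<comment> \<open>The induction hypothesis is used at the level \<open>m\<close> of the larger
        set, which \<open>S - E\<close> may not attain; hence the general \<open>M\<close> in the
        statement.\<close>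
      have "(\<Sum>E\<in>crossing U S. z E * (scaled_life (S - E) + s * mean_ell (S - E)))
          \<le> (\<Sum>E\<in>crossing U S. z E * (m * s + exp_max (S - E) (c s)))"
      proof (intro sum_mono mult_left_mono)
        fix E assume E: "E \<in> crossing U S"
        show "scaled_life (S - E) + s * mean_ell (S - E) \<le> m * s + exp_max (S - E) (c s)"
          unfolding c_def using E m_ge s
          by (intro psubset.IH crossing_psubset) auto
        show "0 \<le> z E" using E crossing_subset z_nonneg by blast
      qed
      moreover have "(\<Sum>E\<in>crossing U S. z E * (scaled_life (S - E) + s * mean_ell (S - E)))
          = A * scaled_life S - mean_ell S + s * (cross_rate S * mean_ell S)"
        using scaled_life_rec[OF psubset.hyps] cross_rate_survivor_mean[OF psubset.hyps, of "ell U y"]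
        by (simp add: A_def algebra_simps sum.distrib sum_distrib_left)
      moreover have "(\<Sum>E\<in>crossing U S. z E * (m * s + exp_max (S - E) (c s)))
          = cross_rate S * (m * s) + (\<Sum>E\<in>crossing U S. z E * exp_max (S - E) (c s))"
        by (simp add: cross_rate_def algebra_simps sum.distrib sum_distrib_left)
      \<comment> \<open>Covering cuts count in the factor \<open>A\<close> of the linear part of
        \<open>A * D s\<close> but not in the two sums over crossing cuts; this is their
        surplus.\<close>
      moreover have "0 \<le> cover_rate S * (s * (m - mean_ell S))"
        using cover_rate_nonneg s fm by simp
      ultimately have "m + d - mean_ell S \<le> A * D s"
        using le by (simp add: D_def A_def algebra_simps)
      then show ?thesis using der by blast
    qed
    then obtain D' where D': "\<And>s. 0 \<le> s \<Longrightarrow> (D has_real_derivative D' s) (at s)"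
      "\<And>s. 0 \<le> s \<Longrightarrow> D' s \<le> A * D s"
      by metis
    show ?thesis
    proof (rule nonneg_if_deriv_le_mult[OF D' _ \<open>A > 0\<close> that])
      fix s :: real assume s: "0 \<le> s"
      have "s * mean_ell S \<le> s * m" using s fm by (rule mult_left_mono[rotated])
      then show "- scaled_life S \<le> D s"
        using exp_max0[OF s] by (simp add: D_def mult.commute)
    qed
  qed
  have mM: "m \<le> M" using x0 psubset.prems(2) by metis
  \<comment> \<open>Passing from level \<open>m\<close> to \<open>M\<close> multiplies every
    \<open>c t x\<close> by \<open>r\<close>, and \<open>- ln r = (M - m) * t\<close> is the gain in
    the linear term.\<close>
  define r where "r = exp (- (M - m) * t)"
  have "exp_max S (c t) \<le> exp_max S (\<lambda>x. r * c t x) - ln r"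
    using psubset.hyps c01 psubset.prems mM by (intro exp_max_le_scaled) (auto simp: r_def mult_nonpos_nonneg)
  also have "(\<lambda>x. r * c t x) = (\<lambda>x. exp (- (M - ell U y x) * t))"
    by (auto simp: r_def c_def exp_add[symmetric] algebra_simps)
  finally show ?case
    using D_nonneg[OF psubset.prems(3)] by (simp add: D_def r_def algebra_simps)
qed

text \<open>At time 0 all shifts vanish, and the potential is the expected maximum of
  \<open>card S\<close> independent standard exponentials.\<close>

lemma scaled_life_le_harm:
  assumes "finite S"
  shows "scaled_life S \<le> harm (card S)"
proof (cases "S = {}")
  case False
  have "scaled_life S + 0 * mean_ell S \<le> Max (ell U y ` S) * 0 + exp_max S (\<lambda>x. exp (- (Max (ell U y ` S) - ell U y x) * 0))"
    using assms False by (intro scaled_life_potential) auto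
  then show ?thesis using exp_max_one[OF assms] by simp
qed (simp add: harm_def)

end

section \<open>The contribution of the cuts avoiding the chosen point\<close>

locale pointed_cut_family =
  fixes U :: "'a set" and z :: "'a set \<Rightarrow> real" and p :: 'a
  assumes finU: "finite U" and z_nonneg: "E \<subseteq> U \<Longrightarrow> 0 \<le> z E"
begin

sublocale cut_family U z "\<lambda>E. of_bool (p \<notin> E) * z E"
  by unfold_locales (auto simp: finU z_nonneg)

text \<open>A survivor other than \<open>p\<close> requires a crossing cut \<open>B\<close> containing \<open>p\<close>. Whatever the arrival
  time of the first such \<open>B\<close>, the survivor is the one obtained by starting from \<open>S - B\<close>, and \<open>B\<close>
  must arrive before any cut avoiding \<open>p\<close> hits that survivor.\<close>

lemma mean_ell_le_sum_scaled_life: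
  assumes "S \<subseteq> U" "p \<in> S"
  shows "mean_ell S \<le> (\<Sum>B\<in>{B. B \<subseteq> U \<and> p \<in> B}. z B * scaled_life (S - B))"
proof -
  have "finite S" using assms finU finite_subset by auto
  then show ?thesis using assms
  proof (induction S rule: finite_psubset_induct)
    case (psubset S)
    define \<B> where "\<B> = {B. B \<subseteq> U \<and> p \<in> B}"
    define \<A> where "\<A> = {A. A \<subseteq> U \<and> p \<notin> A \<and> A \<inter> S \<noteq> {}}"
    have fin: "finite \<A>" "finite \<B>"
      using finU by (auto simp: \<A>_def \<B>_def)
    have fin': "finite (S - B)" for B using psubset.hyps by simp
    have rhs0: "0 \<le> (\<Sum>B\<in>\<B>. z B * scaled_life (S - B))"
      using z_nonneg scaled_life_nonneg[OF fin'] by (intro sum_nonneg) (auto simp: \<B>_def)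
    \<comment> \<open>A cut in \<open>\<A>\<close> meets \<open>S\<close> but leaves
      \<open>p\<close> behind, so it crosses.\<close>
    have split: "crossing U S = \<A> \<union> (crossing U S \<inter> \<B>)" "\<A> \<inter> (crossing U S \<inter> \<B>) = {}"
      using psubset.prems by (auto simp: crossing_def \<A>_def \<B>_def)
    \<comment> \<open>This is the recursion of \<open>scaled_life\<close> at \<open>S - B\<close>,
      run with the total rate of \<open>S\<close>; cuts without effect on \<open>S - B\<close> only
      idle.\<close>
    have key: "(\<Sum>A\<in>\<A>. z A * scaled_life (S - A - B)) + mean_ell (S - B) \<le> cross_rate S * scaled_life (S - B)"
      if B: "B \<in> crossing U S \<inter> \<B>" for B
    proof -
      define R where "R = S - B"
      have R: "finite R" "R \<subseteq> S" "R \<noteq> {}" "p \<notin> R"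
        using B psubset.hyps by (auto simp: R_def crossing_def \<B>_def)
      have "(\<Sum>A\<in>\<A>. z A * scaled_life (R - A)) \<le>
          (\<Sum>A\<in>crossing U R. z A * scaled_life (R - A)) + (cross_rate S - cover_rate R - cross_rate R) * scaled_life R"
      proof -
        have cover_rate_R: "cover_rate R = (\<Sum>A\<in>{A \<in> \<A>. R \<subseteq> A}. z A)"
          unfolding cover_rate_def
        proof (intro sum.mono_neutral_cong_right ballI)
          fix E assume "E \<in> {E. E \<subseteq> U \<and> R \<subseteq> E} - {A \<in> \<A>. R \<subseteq> A}"
          then show "of_bool (p \<notin> E) * z E = 0"
            using R by (auto simp: \<A>_def)
        qed (use finU in \<open>auto simp: \<A>_def\<close>)
        \<comment> \<open>Seen from \<open>R\<close>, cuts in \<open>\<A>\<close> cover it, cross it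
          or miss it. The missing ones leave \<open>scaled_life R\<close> unchanged, and their rate
          fits into the surplus \<open>cross_rate S - cover_rate R - cross_rate R\<close>, since
          cuts through \<open>p\<close> that cross \<open>R\<close> also cross
          \<open>S\<close>.\<close>
        define \<A>1 where "\<A>1 = {A \<in> \<A>. R \<subseteq> A}"
        define \<A>2 where "\<A>2 = {A \<in> \<A>. A \<in> crossing U R}"
        define \<A>3 where "\<A>3 = {A \<in> \<A>. A \<inter> R = {}}"
        have \<A>_split: "\<A> = \<A>1 \<union> (\<A>2 \<union> \<A>3)" "\<A>1 \<inter> (\<A>2 \<union> \<A>3) = {}" "\<A>2 \<inter> \<A>3 = {}"
          using R by (auto simp: \<A>1_def \<A>2_def \<A>3_def \<A>_def crossing_def)
        have fins: "finite \<A>1" "finite \<A>2" "finite \<A>3"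
          using fin by (auto simp: \<A>1_def \<A>2_def \<A>3_def)
        have sum_\<A>: "(\<Sum>A\<in>\<A>. h A) = (\<Sum>A\<in>\<A>1. h A) + (\<Sum>A\<in>\<A>2. h A) + (\<Sum>A\<in>\<A>3. h A)"
          for h :: "'a set \<Rightarrow> real"
          using \<A>_split fins by (simp add: sum.union_disjoint)
        have cr: "crossing U R = \<A>2 \<union> (crossing U R \<inter> \<B>)" "\<A>2 \<inter> (crossing U R \<inter> \<B>) = {}"
          using R by (auto simp: \<A>2_def \<A>_def \<B>_def crossing_def)
        have sum_cr: "(\<Sum>A\<in>crossing U R. h A) = (\<Sum>A\<in>\<A>2. h A) + (\<Sum>A\<in>crossing U R \<inter> \<B>. h A)"
          for h :: "'a set \<Rightarrow> real"
          by (subst cr(1), subst sum.union_disjoint) (use fins finU cr in auto)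
        have crS: "cross_rate S = (\<Sum>A\<in>\<A>. z A) + (\<Sum>A\<in>crossing U S \<inter> \<B>. z A)"
          unfolding cross_rate_def by (subst split(1), subst sum.union_disjoint) (use fin finU split in auto)
        have mono: "(\<Sum>A\<in>crossing U R \<inter> \<B>. z A) \<le> (\<Sum>A\<in>crossing U S \<inter> \<B>. z A)"
          using finU z_nonneg R by (intro sum_mono2) (auto simp: crossing_def)
        have "(\<Sum>A\<in>\<A>3. z A) \<le> cross_rate S - cover_rate R - cross_rate R"
          using mono unfolding crS cover_rate_R \<A>1_def[symmetric] sum_\<A> cross_rate_def[of R] sum_cr by simp
        then have "(\<Sum>A\<in>\<A>3. z A) * scaled_life R \<le> (cross_rate S - cover_rate R - cross_rate R) * scaled_life R"
          using scaled_life_nonneg[OF R(1)] by (rule mult_right_mono)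
        moreover have "(\<Sum>A\<in>\<A>3. z A * scaled_life (R - A)) = (\<Sum>A\<in>\<A>3. z A) * scaled_life R"
          unfolding sum_distrib_right by (intro sum.cong refl) (auto simp: \<A>3_def Diff_triv Int_commute)
        moreover have "(\<Sum>A\<in>\<A>1. z A * scaled_life (R - A)) = 0"
        proof (intro sum.neutral ballI)
          fix A assume "A \<in> \<A>1"
          then have "R - A = {}" by (auto simp: \<A>1_def)
          then show "z A * scaled_life (R - A) = 0" by (simp only: scaled_life_empty mult_zero_right)
        qed
        moreover have "0 \<le> (\<Sum>A\<in>crossing U R \<inter> \<B>. z A * scaled_life (R - A))"
          using z_nonneg scaled_life_nonneg R by (intro sum_nonneg mult_nonneg_nonneg) (auto simp: \<B>_def)
        ultimately show ?thesis
          unfolding sum_\<A> sum_cr by simp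
      qed
      moreover have "S - A - B = R - A" for A
        by (auto simp: R_def)
      ultimately show ?thesis
        using scaled_life_rec[OF R(1)] by (simp add: R_def[symmetric] algebra_simps)
    qed
    \<comment> \<open>Condition on the first crossing cut: after one in \<open>\<A>\<close> the
      point \<open>p\<close> is still present and induction applies; one in \<open>\<B>\<close>
      leaves \<open>S - B\<close>.\<close>
    have rec: "cross_rate S * mean_ell S = (\<Sum>A\<in>\<A>. z A * mean_ell (S - A)) + (\<Sum>B\<in>crossing U S \<inter> \<B>. z B * mean_ell (S - B))"
      unfolding cross_rate_survivor_mean[OF psubset.hyps]
      by (subst split(1), subst sum.union_disjoint) (use fin finU split in auto)
    have "(\<Sum>A\<in>\<A>. z A * mean_ell (S - A)) \<le> (\<Sum>A\<in>\<A>. z A * (\<Sum>B\<in>\<B>. z B * scaled_life (S - A - B)))"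
    proof (intro sum_mono mult_left_mono)
      fix A assume A: "A \<in> \<A>"
      show "mean_ell (S - A) \<le> (\<Sum>B\<in>\<B>. z B * scaled_life (S - A - B))"
        unfolding \<B>_def using A psubset.prems by (intro psubset.IH) (auto simp: \<A>_def)
      show "0 \<le> z A" using A z_nonneg by (auto simp: \<A>_def)
    qed
    also have "\<dots> = (\<Sum>A\<in>\<A>. \<Sum>B\<in>\<B>. z B * (z A * scaled_life (S - A - B)))"
      by (simp add: sum_distrib_left mult.left_commute)
    also have "\<dots> = (\<Sum>B\<in>\<B>. \<Sum>A\<in>\<A>. z B * (z A * scaled_life (S - A - B)))"
      by (rule sum.swap)
    \<comment> \<open>A cut through \<open>p\<close> that does not cross \<open>S\<close> contains
      \<open>S\<close> and leaves the empty set, where \<open>scaled_life\<close> is 0.\<close>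
    also have "\<dots> = (\<Sum>B\<in>crossing U S \<inter> \<B>. \<Sum>A\<in>\<A>. z B * (z A * scaled_life (S - A - B)))"
    proof (intro sum.mono_neutral_right fin ballI)
      fix B assume "B \<in> \<B> - crossing U S \<inter> \<B>"
      then have "S - A - B = {}" for A
        using psubset.prems by (auto simp: \<B>_def crossing_def)
      then show "(\<Sum>A\<in>\<A>. z B * (z A * scaled_life (S - A - B))) = 0"
        by (simp only: scaled_life_empty mult_zero_right sum.neutral_const)
    qed auto
    also have "\<dots> = (\<Sum>B\<in>crossing U S \<inter> \<B>. z B * (\<Sum>A\<in>\<A>. z A * scaled_life (S - A - B)))"
      by (simp only: sum_distrib_left)
    finally have "cross_rate S * mean_ell S
        \<le> (\<Sum>B\<in>crossing U S \<inter> \<B>. z B * ((\<Sum>A\<in>\<A>. z A * scaled_life (S - A - B)) + mean_ell (S - B)))"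
      unfolding rec by (simp only: distrib_left sum.distrib add_right_mono)
    also have "\<dots> \<le> (\<Sum>B\<in>crossing U S \<inter> \<B>. z B * (cross_rate S * scaled_life (S - B)))"
      using z_nonneg by (intro sum_mono mult_left_mono key) (auto simp: \<B>_def)
    also have "\<dots> \<le> (\<Sum>B\<in>\<B>. z B * (cross_rate S * scaled_life (S - B)))"
      using z_nonneg scaled_life_nonneg[OF fin'] cross_rate_nonneg
      by (intro sum_mono2 fin mult_nonneg_nonneg) (auto simp: \<B>_def)
    also have "\<dots> = cross_rate S * (\<Sum>B\<in>\<B>. z B * scaled_life (S - B))"
      by (simp only: sum_distrib_left mult.left_commute)
    finally have le: "cross_rate S * mean_ell S \<le> cross_rate S * (\<Sum>B\<in>\<B>. z B * scaled_life (S - B))" .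
    show ?case
    proof (cases "cross_rate S = 0")
      case True
      have "mean_ell S = 0"
      proof (cases "card S = 1")
        case True
        then obtain x where "S = {x}" by (rule card_1_singletonE)
        then have "S = {p}" using psubset.prems by simp
        then show ?thesis by (auto simp: ell_def intro!: sum.neutral)
      next
        case False
        then show ?thesis using psubset.hyps \<open>cross_rate S = 0\<close> by (simp add: survivor_mean_rec cross_rate_def)
      qed
      then show ?thesis using rhs0 by (simp add: \<B>_def)
    next
      case False
      then show ?thesis
        using le cross_rate_nonneg[of S] by (simp add: \<B>_def)
    qed
  qed
qed

end

section \<open>Combining the two kinds of cuts\<close>

theorem theorem5p1:
  fixes U :: "'a set" and z :: "'a set \<Rightarrow> real" and k :: nat and p :: 'a
  assumes "finite U" and "card U = k" and "k \<ge> 1"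
    and "\<And>S. S \<subseteq> U \<Longrightarrow> z S \<ge> 0"
    and "p \<in> U"
  shows "rtf U z U \<le> (1 + harm (k - 1)) * ell U z p"
proof -
  interpret pointed_cut_family U z p
    by unfold_locales (use assms in auto)
  have "ell U z x = ell U (\<lambda>E. of_bool (p \<notin> E) * z E) x + ell U (\<lambda>E. of_bool (p \<in> E) * z E) x" for x
    unfolding ell_def sum.distrib[symmetric] by (intro sum.cong) auto
  then have "ell U z = (\<lambda>x. ell U (\<lambda>E. of_bool (p \<notin> E) * z E) x + ell U (\<lambda>E. of_bool (p \<in> E) * z E) x)"
    by (rule ext)
  then have "rtf U z U = mean_ell U + survivor_mean U z (ell U (\<lambda>E. of_bool (p \<in> E) * z E)) U"
    using assms(1) by (simp add: rtf_eq_survivor_mean survivor_mean_add[symmetric] del: rtf.simps)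
  also have "survivor_mean U z (ell U (\<lambda>E. of_bool (p \<in> E) * z E)) U \<le> ell U z p"
  proof (rule survivor_mean_le)
    show "0 \<le> ell U z p"
      unfolding ell_def using assms(4) by (intro sum_nonneg) auto
    \<comment> \<open>Cuts containing both \<open>x\<close> and \<open>p\<close> are among those
      counted by \<open>ell U z p\<close>, whichever point survives.\<close>
    fix x
    have "ell U (\<lambda>E. of_bool (p \<in> E) * z E) x = (\<Sum>E\<in>{E. E \<subseteq> U \<and> x \<in> E} \<inter> {E. p \<in> E}. z E)"
      unfolding ell_def using assms(1) by (intro sum.mono_neutral_cong_right) auto
    also have "\<dots> \<le> ell U z p"
      unfolding ell_def using assms(1,4) by (intro sum_mono2) auto
    finally show "ell U (\<lambda>E. of_bool (p \<in> E) * z E) x \<le> ell U z p" .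
  qed (use assms in auto)
  also have "mean_ell U \<le> (\<Sum>B\<in>{B. B \<subseteq> U \<and> p \<in> B}. z B * scaled_life (U - B))"
    using assms by (intro mean_ell_le_sum_scaled_life) auto
  also have "\<dots> \<le> (\<Sum>B\<in>{B. B \<subseteq> U \<and> p \<in> B}. z B * harm (k - 1))"
  proof (intro sum_mono mult_left_mono)
    fix B assume B: "B \<in> {B. B \<subseteq> U \<and> p \<in> B}"
    \<comment> \<open>Removing \<open>B\<close> removes \<open>p\<close>, hence the index
      \<open>k - 1\<close> rather than \<open>k\<close>; the remaining weights \<open>z B\<close>
      add up to \<open>ell U z p\<close>.\<close>
    then have "U - B \<subseteq> U - {p}" by auto
    then have "card (U - B) \<le> k - 1"
      using assms by (metis card_Diff_singleton card_mono finite_Diff)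
    then have "(harm (card (U - B)) :: real) \<le> harm (k - 1)"
      by (rule harm_mono)
    then show "scaled_life (U - B) \<le> harm (k - 1)"
      using scaled_life_le_harm[of "U - B"] assms(1) by simp
    show "0 \<le> z B" using B assms(4) by auto
  qed
  finally show ?thesis
    by (simp add: ell_def sum_distrib_right[symmetric] algebra_simps del: rtf.simps)
qed

end
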